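(* Let $B$ be a positive integer and let $T=(t_{ij})$ be a strictly positive real $B\times B$ matrix. Then there exist $r>0$ and $\delta>0$ such that for every complex $B\times B$ matrix $\hat T=(\hat t_{ij})$ with $|t_{ij}-\hat t_{ij}|\le r$ for all $i,j$, the induced map $f_{\hat T}(w)=w\hat T/(w\hat T\mathbf 1)$ is a contraction mapping on $W_{\mathbb C}^{\circ}(\delta)$ under the complex Hilbert metric $d_H$.
   Context: Vectors are row vectors and $\mathbf 1$ is the all-ones column vector in $\mathbb{R}^B$. Let $W=\{w\in\mathbb R^B: w_i\ge 0,\ \sum_i w_i=1\}$ be the standard real simplex and let $W^\circ=\{w\in W: w_i>0 \text{ for all } i\}$ be its interior. Let $W_{\mathbb C}=\{w\in\mathbb C^B:\sum_i w_i=1\}$ and $W_{\mathbb C}^+=\{v\in W_{\mathbb C}:\operatorname{Re}(v_i)>0\text{ for all }i\}$. Complex Hilbert metric: for $v,w\in W_{\mathbb C}^+$, $$d_H(v,w)=\max_{i,j}\left|\log\left(\frac{w_i/w_j}{v_i/v_j}\right)\right|,$$ where $\log$ is the principal branch of the complex logarithm (branch cut along the negative real axis). Relative neighborhood: for $\delta>0$, $$W_{\mathbb C}^{\circ}(\delta)=\{v\in W_{\mathbb C}:\ \exists\, u\in W^\circ \text{ such that } |v_i-u_i|\le\delta|u_i| \text{ for all } i=1,\dots,B\}.$$ When $\delta<1$, $W_{\mathbb C}^{\circ}(\delta)\subset W_{\mathbb C}^+$, so $d_H$ is defined on $W_{\mathbb C}^{\circ}(\delta)$. "$f_{\hat T}$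 is a contraction mapping on $W_{\mathbb C}^{\circ}(\delta)$ under $d_H$" means: $W_{\mathbb C}^{\circ}(\delta)\subset W_{\mathbb C}^+$, $f_{\hat T}$ is well defined on $W_{\mathbb C}^{\circ}(\delta)$ (that is, $w\hat T\mathbf 1\neq 0$) with values in $W_{\mathbb C}^+$ (so that $d_H$ of images makes sense), and there is $0<\rho<1$ such that $d_H(f_{\hat T}(x),f_{\hat T}(y))\le\rho\, d_H(x,y)$ for all $x,y\in W_{\mathbb C}^{\circ}(\delta)$. It is not part of this statement that $f_{\hat T}$ maps $W_{\mathbb C}^{\circ}(\delta)$ into itself. *)

theory Defs
  imports "HOL-Analysis.Analysis"
begin

definition real_simplex :: "(real ^ 'n) set" where
  "real_simplex = {w. (\<forall>i. 0 \<le> w $ i) \<and> (\<Sum>i\<in>UNIV. w $ i) = 1}"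

definition real_simplex_interior :: "(real ^ 'n) set" where
  "real_simplex_interior = {w \<in> real_simplex. \<forall>i. 0 < w $ i}"

definition complex_simplex :: "(complex ^ 'n) set" where
  "complex_simplex = {w. (\<Sum>i\<in>UNIV. w $ i) = 1}"

definition complex_simplex_pos :: "(complex ^ 'n) set" where
  "complex_simplex_pos = {v \<in> complex_simplex. \<forall>i. 0 < Re (v $ i)}"

definition relative_nbhd :: "real \<Rightarrow> (complex ^ 'n) set" where
  "relative_nbhd \<delta> =
     {v \<in> complex_simplex. \<exists>u \<in> real_simplex_interior.
        \<forall>i. cmod (v $ i - complex_of_real (u $ i)) \<le> \<delta> * \<bar>u $ i\<bar>}"

text \<open>
  Only meaningful on \<^const>\<open>complex_simplex_pos\<close>, where all components are nonzero.
  The argument of \<^const>\<open>Ln\<close> may lie on the negative real axis; the modulus of the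
  logarithm does not depend on which of the two boundary values is taken there.
\<close>
definition complex_hilbert_dist :: "complex ^ 'n \<Rightarrow> complex ^ 'n \<Rightarrow> real" where
  "complex_hilbert_dist v w =
     Max (range (\<lambda>(i, j). cmod (Ln ((w $ i / w $ j) / (v $ i / v $ j)))))"

text \<open>The scalar \<open>w A 1\<close>, where \<open>1\<close> is the all-ones column vector.\<close>
definition total_mass :: "complex ^ 'n ^ 'n \<Rightarrow> complex ^ 'n \<Rightarrow> complex" where
  "total_mass A w = (\<Sum>j\<in>UNIV. (w v* A) $ j)"

definition induced_map :: "complex ^ 'n ^ 'n \<Rightarrow> complex ^ 'n \<Rightarrow> complex ^ 'n" where
  "induced_map A w = (\<chi> j. (w v* A) $ j / total_mass A w)"

text \<open>Invariance of \<open>S\<close> under the induced map is deliberately not required.\<close>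
definition induced_contraction_on :: "complex ^ 'n ^ 'n \<Rightarrow> (complex ^ 'n) set \<Rightarrow> bool" where
  "induced_contraction_on A S \<longleftrightarrow>
     S \<subseteq> complex_simplex_pos \<and>
     (\<forall>w\<in>S. total_mass A w \<noteq> 0 \<and> induced_map A w \<in> complex_simplex_pos) \<and>
     (\<exists>\<rho>. 0 < \<rho> \<and> \<rho> < 1 \<and>
        (\<forall>x\<in>S. \<forall>y\<in>S.
           complex_hilbert_dist (induced_map A x) (induced_map A y) \<le> \<rho> * complex_hilbert_dist x y))"

end

theory Submission
  imports Defs
begin

text \<open>
  Write \<open>y\<^sub>i = x\<^sub>i exp a\<^sub>i\<close> and join \<open>x\<close> to \<open>y\<close> by \<open>x\<^sub>i(t) = x\<^sub>i exp (t a\<^sub>i)\<close>. The arguments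
  of the \<open>x\<^sub>i(t)\<close> stay small, so the \<open>x\<^sub>i(t)\<close> are relatively close to the positive numbers
  \<open>|x\<^sub>i(t)|\<close>, and the Hilbert distance of \<open>x\<close> and \<open>y\<close> is the diameter \<open>D\<close> of the set of all \<open>a\<^sub>i\<close>.
  The logarithmic derivative of the \<open>p\<close>-th entry of \<open>x(t) T'\<close> is the average of the \<open>a\<^sub>i\<close> with
  weights proportional to \<open>x\<^sub>i(t) T'\<^sub>i\<^sub>p\<close>. Up to a relative error \<open>O(\<eta>)\<close> these weights form a
  probability vector that dominates \<open>\<kappa> |x\<^sub>i(t)| / \<Sum>\<^sub>k |x\<^sub>k(t)|\<close>, whatever \<open>p\<close> is. This common part cancels
  between two columns, hence the two averages differ by at most \<open>(1 - \<kappa> + O(\<eta>)) D\<close>; integrate over \<open>t\<close>.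
\<close>

section \<open>Averages of a family of given diameter\<close>

text \<open>The common part \<open>c\<close> cancels, and the two nonnegative remainders have equal
  mass 1 - \<kappa>, so only differences \<open>a i - a j\<close> matter.\<close>

lemma norm_sum_diff_overlap:
  fixes a :: "'n::finite \<Rightarrow> complex" and p q c :: "'n \<Rightarrow> real"
  assumes "\<And>i. c i \<le> p i" "\<And>i. c i \<le> q i"
    and "sum p UNIV = 1" "sum q UNIV = 1" and "sum c UNIV = \<kappa>" "\<kappa> < 1"
    and D: "\<And>i j. cmod (a i - a j) \<le> D"
  shows "cmod ((\<Sum>i\<in>UNIV. a i * of_real (p i)) - (\<Sum>i\<in>UNIV. a i * of_real (q i))) \<le> (1 - \<kappa>) * D"
proof -
  define \<alpha> where "\<alpha> i = p i - c i" for i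
  define \<beta> where "\<beta> i = q i - c i" for i
  define E where "E = (\<Sum>i\<in>UNIV. a i * of_real (p i)) - (\<Sum>i\<in>UNIV. a i * of_real (q i))"
  have \<alpha>: "\<alpha> i \<ge> 0" and \<beta>: "\<beta> i \<ge> 0" for i
    using assms(1,2)[of i] by (auto simp: \<alpha>_def \<beta>_def)
  have s\<alpha>: "sum \<alpha> UNIV = 1 - \<kappa>" and s\<beta>: "sum \<beta> UNIV = 1 - \<kappa>"
    using assms by (simp_all add: \<alpha>_def \<beta>_def sum_subtractf)
  have E: "E = (\<Sum>i\<in>UNIV. a i * of_real (\<alpha> i)) - (\<Sum>j\<in>UNIV. a j * of_real (\<beta> j))"
    by (simp add: E_def \<alpha>_def \<beta>_def algebra_simps sum_subtractf)
  \<comment> \<open>The extra factor 1 - \<kappa>, the mass of either remainder, allows coupling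
    them by the product weights \<open>\<alpha> i * \<beta> j\<close>; it is divided out at the
    end.\<close>
  have "of_real (1 - \<kappa>) * E = (\<Sum>i\<in>UNIV. a i * of_real (\<alpha> i)) * of_real (sum \<beta> UNIV)
      - of_real (sum \<alpha> UNIV) * (\<Sum>j\<in>UNIV. a j * of_real (\<beta> j))"
    unfolding s\<alpha> s\<beta> E by (simp add: algebra_simps)
  also have "\<dots> = (\<Sum>i\<in>UNIV. \<Sum>j\<in>UNIV. (a i - a j) * of_real (\<alpha> i * \<beta> j))"
    unfolding of_real_sum sum_product by (simp add: sum_subtractf algebra_simps)
  also have "cmod \<dots> \<le> (\<Sum>i\<in>UNIV. \<Sum>j\<in>UNIV. D * (\<alpha> i * \<beta> j))"
  proof (intro sum_norm_le)
    fix i j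
    show "cmod ((a i - a j) * of_real (\<alpha> i * \<beta> j)) \<le> D * (\<alpha> i * \<beta> j)"
      using \<alpha>[of i] \<beta>[of j] D[of i j] by (auto simp: norm_mult intro!: mult_right_mono)
  qed
  also have "\<dots> = D * (sum \<alpha> UNIV * sum \<beta> UNIV)"
    unfolding sum_product by (simp flip: sum_distrib_left)
  also have "\<dots> = (1 - \<kappa>) * ((1 - \<kappa>) * D)"
    by (simp add: s\<alpha> s\<beta>)
  finally have "(1 - \<kappa>) * cmod E \<le> (1 - \<kappa>) * ((1 - \<kappa>) * D)"
    using \<open>\<kappa> < 1\<close> unfolding norm_mult norm_of_real by simp
  then show ?thesis
    using \<open>\<kappa> < 1\<close> unfolding E_def by simp
qed

text \<open>Since \<open>z\<close> has total mass 0, any fixed value \<open>a k\<close> may be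
  subtracted from all \<open>a i\<close>.\<close>

lemma norm_sum_zero_mass:
  fixes a z :: "'n::finite \<Rightarrow> complex"
  assumes "sum z UNIV = 0" and "\<And>i j. cmod (a i - a j) \<le> D"
  shows "cmod (\<Sum>i\<in>UNIV. a i * z i) \<le> D * (\<Sum>i\<in>UNIV. cmod (z i))"
proof -
  fix k :: 'n
  have "(\<Sum>i\<in>UNIV. a i * z i) = (\<Sum>i\<in>UNIV. a i * z i) - a k * sum z UNIV"
    using assms by simp
  also have "\<dots> = (\<Sum>i\<in>UNIV. (a i - a k) * z i)"
    by (simp add: sum_distrib_left sum_subtractf algebra_simps)
  also have "cmod \<dots> \<le> (\<Sum>i\<in>UNIV. D * cmod (z i))"
    using assms(2) by (intro sum_norm_le) (auto simp: norm_mult intro!: mult_right_mono)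
  finally show ?thesis by (simp add: sum_distrib_left)
qed

section \<open>Complex numbers relatively close to positive reals\<close>

lemma sum_rel_close:
  fixes w :: "'n::finite \<Rightarrow> complex" and v :: "'n \<Rightarrow> real"
  assumes "\<And>i. cmod (w i - of_real (v i)) \<le> \<eta> * v i"
  shows "cmod (sum w UNIV - of_real (sum v UNIV)) \<le> \<eta> * sum v UNIV"
proof -
  have "sum w UNIV - of_real (sum v UNIV) = (\<Sum>i\<in>UNIV. w i - of_real (v i))"
    by (simp add: sum_subtractf)
  also have "cmod \<dots> \<le> (\<Sum>i\<in>UNIV. \<eta> * v i)"
    by (intro sum_norm_le) (use assms in auto)
  finally show ?thesis by (simp add: sum_distrib_left)
qed

text \<open>Over a common denominator the two errors contribute \<eta> each; dividing by
  \<open>cmod W\<close>, which is at least \<open>V / 2\<close>, doubles their sum.\<close>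

lemma divide_rel_close:
  fixes w W :: complex and v V \<eta> :: real
  assumes "cmod (w - of_real v) \<le> \<eta> * v" "cmod (W - of_real V) \<le> \<eta> * V"
    and "0 < v" "0 < V" "\<eta> \<le> 1 / 2"
  shows "W \<noteq> 0" "cmod (w / W - of_real (v / V)) \<le> 4 * \<eta> * (v / V)"
proof -
  have "\<eta> * V \<le> 1 / 2 * V" using assms by (intro mult_right_mono) auto
  moreover have "V \<le> cmod W + cmod (W - of_real V)"
    using norm_triangle_sub[of "of_real V" W] \<open>0 < V\<close> by (simp add: norm_minus_commute)
  ultimately have W: "V \<le> 2 * cmod W" using assms(2) by linarith
  then show "W \<noteq> 0" using \<open>0 < V\<close> by auto
  have "w / W - of_real (v / V) = ((w - of_real v) * of_real V - (W - of_real V) * of_real v) / (W * of_real V)"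
    using \<open>W \<noteq> 0\<close> \<open>0 < V\<close> by (simp add: field_simps)
  also have "cmod \<dots> \<le> (\<eta> * v * V + \<eta> * V * v) / (cmod W * V)"
    unfolding norm_divide norm_mult norm_of_real
    using assms by (intro divide_mono order.trans[OF norm_triangle_ineq4] add_mono)
      (auto simp: norm_mult W \<open>W \<noteq> 0\<close> intro!: mult_right_mono add_nonneg_nonneg)
  also have "\<dots> = 2 * (\<eta> * v) / cmod W"
    using \<open>0 < V\<close> by (simp add: field_simps)
  also have "\<dots> \<le> 2 * (\<eta> * v) / (V / 2)"
    using W \<open>0 < V\<close> order.trans[OF norm_ge_zero assms(1)]
    by (intro divide_left_mono) (auto intro!: mult_pos_pos)
  finally show "cmod (w / W - of_real (v / V)) \<le> 4 * \<eta> * (v / V)"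
    by (simp add: field_simps)
qed

text \<open>Scaling by the positive \<open>v\<close> keeps the argument, so it suffices to bound
  \<open>Ln (1 + z)\<close> with \<open>cmod z\<close> at most \<eta>.\<close>

lemma Im_Ln_rel_close:
  assumes "cmod (w - of_real v) \<le> \<eta> * v" "0 < v" "\<eta> < 1 / 2"
  shows "w \<noteq> 0" "0 < Re w" "\<bar>Im (Ln w)\<bar> \<le> 2 * \<eta>"
proof -
  have "\<bar>Re w - v\<bar> \<le> \<eta> * v"
    using abs_Re_le_cmod[of "w - of_real v"] assms(1) by simp
  moreover have "\<eta> * v < 1 / 2 * v" using assms by (intro mult_strict_right_mono) auto
  ultimately show "0 < Re w" using assms(2) by linarith
  then show w: "w \<noteq> 0" by auto
  define z where "z = w / of_real v - 1"
  have "z = (w - of_real v) / of_real v" using assms(2) by (simp add: z_def diff_divide_distrib)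
  then have "cmod z = cmod (w - of_real v) / v" using assms(2) by (simp add: norm_divide)
  then have z: "cmod z \<le> \<eta>" using assms by (simp add: pos_divide_le_eq)
  have "w = of_real v * (1 + z)" using assms(2) by (simp add: z_def)
  moreover have "1 + z \<noteq> 0" using w calculation by auto
  ultimately have "Im (Ln w) = Im (Ln (1 + z))"
    using assms(2) by (simp add: Ln_times_of_real)
  also have "\<bar>\<dots>\<bar> \<le> 2 * cmod z"
    using z assms by (intro order.trans[OF abs_Im_le_cmod] norm_Ln_le) auto
  finally show "\<bar>Im (Ln w)\<bar> \<le> 2 * \<eta>" using z by simp
qed

text \<open>The right-hand side has imaginary part at most 4 * (1/2) = 2 < \<pi> in modulus, so no
  multiple of 2\<pi>i appears.\<close>

lemma Ln_cross_ratio: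
  assumes "x1 \<noteq> 0" "x2 \<noteq> 0" "y1 \<noteq> 0" "y2 \<noteq> 0"
    and "\<bar>Im (Ln x1)\<bar> \<le> 1 / 2" "\<bar>Im (Ln x2)\<bar> \<le> 1 / 2" "\<bar>Im (Ln y1)\<bar> \<le> 1 / 2" "\<bar>Im (Ln y2)\<bar> \<le> 1 / 2"
  shows "Ln ((y1 / y2) / (x1 / x2)) = (Ln y1 - Ln x1) - (Ln y2 - Ln x2)"
proof -
  have "(y1 / y2) / (x1 / x2) = exp ((Ln y1 - Ln x1) - (Ln y2 - Ln x2))"
    using assms(1-4) by (simp add: exp_diff exp_Ln)
  also have "Ln \<dots> = (Ln y1 - Ln x1) - (Ln y2 - Ln x2)"
    using assms(5-8) pi_gt3 by (intro Ln_exp) auto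
  finally show ?thesis .
qed

text \<open>Replacing each complex weight family by its normalized real model costs
  \<open>4 * \<eta> * D\<close>; the two real averages are then compared by overlap.\<close>

lemma weighted_average_diff_bound:
  fixes a w w' :: "'n::finite \<Rightarrow> complex" and u v v' :: "'n \<Rightarrow> real"
  assumes w: "\<And>i. cmod (w i - of_real (v i)) \<le> \<eta> * v i"
    and w': "\<And>i. cmod (w' i - of_real (v' i)) \<le> \<eta> * v' i"
    and pos: "\<And>i. 0 < v i" "\<And>i. 0 < v' i" and \<eta>: "0 \<le> \<eta>" "\<eta> \<le> 1 / 2"
    and c: "\<And>i. c i \<le> v i / sum v UNIV" "\<And>i. c i \<le> v' i / sum v' UNIV"
    and \<kappa>: "sum c UNIV = \<kappa>" "\<kappa> < 1"
    and D: "\<And>i j. cmod (a i - a j) \<le> D"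
  shows "cmod ((\<Sum>i\<in>UNIV. a i * w i) / sum w UNIV - (\<Sum>i\<in>UNIV. a i * w' i) / sum w' UNIV)
    \<le> (1 - \<kappa> + 8 * \<eta>) * D"
proof -
  have *: "cmod ((\<Sum>i\<in>UNIV. a i * w i) / sum w UNIV - (\<Sum>i\<in>UNIV. a i * of_real (v i / sum v UNIV))) \<le> D * (4 * \<eta>)"
    if w: "\<And>i. cmod (w i - of_real (v i)) \<le> \<eta> * v i" and v: "\<And>i. 0 < v i"
    for w :: "'n \<Rightarrow> complex" and v :: "'n \<Rightarrow> real"
  proof -
    define z where "z i = w i / sum w UNIV - of_real (v i / sum v UNIV)" for i
    have V: "0 < sum v UNIV" using v by (intro sum_pos) auto
    note rel = divide_rel_close[OF w sum_rel_close[OF w] v V \<eta>(2)]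
    \<comment> \<open>Both weight families are normalized to total mass 1.\<close>
    have z: "sum z UNIV = 0"
      using rel(1) V by (simp add: z_def sum_subtractf flip: sum_divide_distrib of_real_sum)
    have "D \<ge> 0" using D[of undefined undefined] by simp
    have "(\<Sum>i\<in>UNIV. a i * w i) / sum w UNIV - (\<Sum>i\<in>UNIV. a i * of_real (v i / sum v UNIV)) = (\<Sum>i\<in>UNIV. a i * z i)"
      by (simp add: z_def algebra_simps sum_subtractf sum_divide_distrib)
    also have "cmod \<dots> \<le> D * (\<Sum>i\<in>UNIV. cmod (z i))"
      by (rule norm_sum_zero_mass[OF z D])
    also have "\<dots> \<le> D * (\<Sum>i\<in>UNIV. 4 * \<eta> * (v i / sum v UNIV))"
      using \<open>D \<ge> 0\<close> rel(2) by (intro mult_left_mono sum_mono) (auto simp: z_def)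
    also have "(\<Sum>i\<in>UNIV. 4 * \<eta> * (v i / sum v UNIV)) = 4 * \<eta>"
      using V by (simp flip: sum_distrib_left sum_divide_distrib)
    finally show ?thesis .
  qed
  have V: "0 < sum v UNIV" "0 < sum v' UNIV" using pos by (auto intro: sum_pos)
  have **: "cmod ((\<Sum>i\<in>UNIV. a i * of_real (v i / sum v UNIV)) - (\<Sum>i\<in>UNIV. a i * of_real (v' i / sum v' UNIV))) \<le> (1 - \<kappa>) * D"
    using V c \<kappa> D by (intro norm_sum_diff_overlap[where c = c]) (auto simp flip: sum_divide_distrib)
  have "cmod ((\<Sum>i\<in>UNIV. a i * w i) / sum w UNIV - (\<Sum>i\<in>UNIV. a i * w' i) / sum w' UNIV)
     \<le> D * (4 * \<eta>) + (1 - \<kappa>) * D + D * (4 * \<eta>)"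
    by (intro norm_diff_triangle_le[OF norm_diff_triangle_le[OF *[OF w pos(1)] **]])
      (subst norm_minus_commute, rule *[OF w' pos(2)])
  then show ?thesis by (simp add: algebra_simps)
qed

lemma complex_hilbert_dist_le_iff:
  "complex_hilbert_dist v w \<le> d \<longleftrightarrow> (\<forall>i j. cmod (Ln ((w $ i / w $ j) / (v $ i / v $ j))) \<le> d)"
  unfolding complex_hilbert_dist_def by (subst Max_le_iff) auto

section \<open>Perturbations of a positive matrix\<close>

text \<open>\<kappa> bounds the ratios within a column from below; \<eta> bounds both the relative
  error of the entries and the arguments of the vector components. Together these give relative
  errors of at most \<open>3 * \<eta>\<close>.\<close>

locale positive_matrix_perturbation =
  fixes T :: "real ^ 'n ^ 'n" and T' :: "complex ^ 'n ^ 'n" and \<kappa> \<eta> :: real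
  assumes T_pos: "\<And>i j. 0 < T $ i $ j"
    and T_ratio: "\<And>i j k. \<kappa> * T $ k $ j \<le> T $ i $ j"
    and T'_close: "\<And>i j. cmod (T' $ i $ j - of_real (T $ i $ j)) \<le> \<eta> * T $ i $ j"
    and \<eta>_pos: "0 < \<eta>" and \<eta>_less: "3 * \<eta> < 1 / 16"
    and \<kappa>_less: "\<kappa> < 1"
begin

text \<open>The radius \<open>\<eta> / 2\<close> compensates the factor 2 in
  \<open>Im_Ln_rel_close\<close>.\<close>

lemma relative_nbhd_close:
  assumes "x \<in> relative_nbhd (\<eta> / 2)"
  shows "x $ i \<noteq> 0" "0 < Re (x $ i)" "\<bar>Im (Ln (x $ i))\<bar> \<le> \<eta>"
proof -
  obtain u where "cmod (x $ i - of_real (u $ i)) \<le> \<eta> / 2 * u $ i" "0 < u $ i"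
    using assms unfolding relative_nbhd_def real_simplex_interior_def by (auto simp: abs_of_pos)
  from Im_Ln_rel_close[OF this] \<eta>_less \<eta>_pos
  show "x $ i \<noteq> 0" "0 < Re (x $ i)" "\<bar>Im (Ln (x $ i))\<bar> \<le> \<eta>" by auto
qed

lemma exp_times_entry_close:
  assumes "\<bar>Im b\<bar> \<le> \<eta>"
  shows "cmod (exp b * T' $ i $ j - of_real (exp (Re b) * T $ i $ j)) \<le> 3 * \<eta> * (exp (Re b) * T $ i $ j)"
proof -
  have "cmod (exp (\<i> * of_real (Im b)) - 1) \<le> \<bar>Im b\<bar>"
    using abs_sin_x_le_abs_x[of "Im b / 2"] by (simp add: dist_exp_i_1)
  then have 1: "cmod (exp (\<i> * of_real (Im b)) - 1) \<le> \<eta>" using assms by simp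
  have "exp b = of_real (exp (Re b)) * exp (\<i> * of_real (Im b))"
    by (metis complex_eq exp_add exp_of_real)
  \<comment> \<open>The unimodular phase multiplies the entry error, so the phase error and the
    entry error add without a product term.\<close>
  then have "exp b * T' $ i $ j - of_real (exp (Re b) * T $ i $ j) =
     of_real (exp (Re b)) * (exp (\<i> * of_real (Im b)) * (T' $ i $ j - of_real (T $ i $ j))
       + (exp (\<i> * of_real (Im b)) - 1) * of_real (T $ i $ j))"
    by (simp add: algebra_simps)
  also have "cmod \<dots> \<le> exp (Re b) * (1 * (\<eta> * T $ i $ j) + \<eta> * T $ i $ j)"
    unfolding norm_mult norm_of_real
    using 1 T'_close[of i j] T_pos[of i j]
    by (intro mult_mono order.trans[OF norm_triangle_ineq] add_mono)
       (auto simp: norm_mult intro!: mult_mono)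
  also have "\<dots> \<le> 3 * \<eta> * (exp (Re b) * T $ i $ j)"
    using \<eta>_pos T_pos[of i j] by (simp add: algebra_simps)
  finally show ?thesis .
qed

text \<open>Positive terms cannot cancel, so the relative error survives summation. The sum thus
  avoids the branch cut and has a small enough argument for \<open>Ln_cross_ratio\<close>.\<close>

lemma column_sum_close:
  fixes b :: "'n \<Rightarrow> complex" and j :: 'n
  assumes "\<And>i. \<bar>Im (b i)\<bar> \<le> \<eta>"
  defines "S \<equiv> \<Sum>i\<in>UNIV. exp (b i) * T' $ i $ j"
  shows "S \<noteq> 0" "0 < Re S" "\<bar>Im (Ln S)\<bar> \<le> 1 / 2"
    and "cmod (S - of_real (\<Sum>i\<in>UNIV. exp (Re (b i)) * T $ i $ j)) \<le> 3 * \<eta> * (\<Sum>i\<in>UNIV. exp (Re (b i)) * T $ i $ j)"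
proof -
  show *: "cmod (S - of_real (\<Sum>i\<in>UNIV. exp (Re (b i)) * T $ i $ j)) \<le> 3 * \<eta> * (\<Sum>i\<in>UNIV. exp (Re (b i)) * T $ i $ j)"
    unfolding S_def using assms by (intro sum_rel_close exp_times_entry_close)
  have "0 < (\<Sum>i\<in>UNIV. exp (Re (b i)) * T $ i $ j)" using T_pos by (intro sum_pos) auto
  from Im_Ln_rel_close[OF * this] \<eta>_less
  show "S \<noteq> 0" "0 < Re S" "\<bar>Im (Ln S)\<bar> \<le> 1 / 2" by auto
qed

lemma vector_matrix_mult_exp_Ln:
  assumes "x \<in> relative_nbhd (\<eta> / 2)"
  shows "(x v* T') $ j = (\<Sum>i\<in>UNIV. exp (Ln (x $ i)) * T' $ i $ j)"
  using relative_nbhd_close(1)[OF assms] by (simp add: vector_matrix_mult_def mult.commute)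

text \<open>Numerator and total mass are both within relative error \<open>3 * \<eta>\<close> of
  positive reals, so each quotient is within \<open>12 * \<eta>\<close> < 1/4 of one.\<close>

lemma induced_map_in_simplex_pos:
  assumes x: "x \<in> relative_nbhd (\<eta> / 2)"
  shows "total_mass T' x \<noteq> 0" "induced_map T' x \<in> complex_simplex_pos"
proof -
  define V where "V j = (\<Sum>i\<in>UNIV. exp (Re (Ln (x $ i))) * T $ i $ j)" for j
  have V: "0 < V j" for j unfolding V_def using T_pos by (intro sum_pos) auto
  have close: "cmod ((x v* T') $ j - of_real (V j)) \<le> 3 * \<eta> * V j" for j
    unfolding vector_matrix_mult_exp_Ln[OF x] V_def
    using relative_nbhd_close(3)[OF x] by (intro column_sum_close)
  have close': "cmod (total_mass T' x - of_real (sum V UNIV)) \<le> 3 * \<eta> * sum V UNIV"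
    unfolding total_mass_def using close by (rule sum_rel_close)
  have sV: "0 < sum V UNIV" using V by (intro sum_pos) auto
  have "3 * \<eta> \<le> 1 / 2" using \<eta>_less by simp
  note rel = divide_rel_close[OF close close' V sV this]
  show tm: "total_mass T' x \<noteq> 0" by (rule rel(1))
  have "0 < Re (induced_map T' x $ j)" for j
    using Im_Ln_rel_close(2)[OF rel(2)[of j]] V sV \<eta>_less by (simp add: induced_map_def)
  moreover have "(\<Sum>j\<in>UNIV. induced_map T' x $ j) = 1"
    using tm by (simp add: induced_map_def total_mass_def flip: sum_divide_distrib)
  ultimately show "induced_map T' x \<in> complex_simplex_pos"
    by (simp add: complex_simplex_pos_def complex_simplex_def)
qed

text \<open>This is the mean value inequality on the segment from 0 to 1. The derivative of
  \<open>Ln (S z p) - Ln (S z q)\<close> is a difference of two weighted averages of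
  \<open>a\<close>.\<close>

lemma log_column_ratio_bound:
  fixes b a :: "'n \<Rightarrow> complex"
  assumes b: "\<And>i. \<bar>Im (b i)\<bar> \<le> \<eta>" "\<And>i. \<bar>Im (b i + a i)\<bar> \<le> \<eta>"
    and D: "\<And>i j. cmod (a i - a j) \<le> D"
  defines "S \<equiv> \<lambda>z j. \<Sum>i\<in>UNIV. exp (b i + z * a i) * T' $ i $ j"
  shows "cmod ((Ln (S 1 p) - Ln (S 1 q)) - (Ln (S 0 p) - Ln (S 0 q))) \<le> (1 - \<kappa> + 24 * \<eta>) * D"
proof -
  define S' where "S' z j = (\<Sum>i\<in>UNIV. a i * (exp (b i + z * a i) * T' $ i $ j))" for z j
  let ?I = "closed_segment 0 (1::complex)"
  \<comment> \<open>For real \<open>z\<close> the imaginary part is a convex combination of its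
    values at the endpoints.\<close>
  have Im_b: "\<bar>Im (b i + z * a i)\<bar> \<le> \<eta>" if z: "z \<in> ?I" for z i
  proof -
    obtain t where t: "z = of_real t" "0 \<le> t" "t \<le> 1"
      using z by (auto simp: closed_segment_def scaleR_conv_of_real)
    have "\<bar>Im (b i + z * a i)\<bar> = \<bar>(1 - t) * Im (b i) + t * Im (b i + a i)\<bar>"
      by (simp add: t algebra_simps)
    also have "\<dots> \<le> (1 - t) * \<bar>Im (b i)\<bar> + t * \<bar>Im (b i + a i)\<bar>"
      using t by (intro order.trans[OF abs_triangle_ineq]) (simp add: abs_mult)
    also have "\<dots> \<le> (1 - t) * \<eta> + t * \<eta>"
      using t b by (intro add_mono mult_left_mono) auto
    finally show ?thesis by (simp add: algebra_simps)
  qed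
  have DS: "((\<lambda>z. S z j) has_field_derivative S' z j) (at z within ?I)" for z j
    unfolding S_def S'_def by (auto intro!: derivative_eq_intros sum.cong simp: mult_ac)
  have DL: "((\<lambda>z. Ln (S z p) - Ln (S z q)) has_field_derivative S' z p / S z p - S' z q / S z q) (at z within ?I)"
    if z: "z \<in> ?I" for z
  proof -
    have "S z j \<notin> \<real>\<^sub>\<le>\<^sub>0" for j
      using column_sum_close(2)[of "\<lambda>i. b i + z * a i" j, OF Im_b[OF z]]
      by (auto simp: S_def complex_nonpos_Reals_iff)
    then show ?thesis
      by (auto intro!: derivative_eq_intros DS simp: divide_inverse)
  qed
  have bound: "cmod (S' z p / S z p - S' z q / S z q) \<le> (1 - \<kappa> + 24 * \<eta>) * D" if z: "z \<in> ?I" for z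
  proof -
    define u where "u i = exp (Re (b i + z * a i))" for i
    \<comment> \<open>The part of mass \<kappa> shared by all columns: it depends on the path point
      but not on \<open>j\<close>, and \<open>T_ratio\<close> makes every column's weights dominate
      it.\<close>
    define c where "c i = \<kappa> * (u i / sum u UNIV)" for i
    have u: "0 < u i" for i by (simp add: u_def)
    then have su: "0 < sum u UNIV" by (intro sum_pos) auto
    have c: "c i \<le> u i * T $ i $ j / (\<Sum>k\<in>UNIV. u k * T $ k $ j)" for i j
    proof -
      have "\<kappa> * (\<Sum>k\<in>UNIV. u k * T $ k $ j) = (\<Sum>k\<in>UNIV. u k * (\<kappa> * T $ k $ j))"
        by (simp add: sum_distrib_left mult_ac)
      also have "\<dots> \<le> (\<Sum>k\<in>UNIV. u k * T $ i $ j)"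
        using u T_ratio by (intro sum_mono mult_left_mono) (auto intro: less_imp_le)
      finally have "\<kappa> * (\<Sum>k\<in>UNIV. u k * T $ k $ j) \<le> sum u UNIV * T $ i $ j"
        by (simp add: sum_distrib_right)
      then have "u i * (\<kappa> * (\<Sum>k\<in>UNIV. u k * T $ k $ j)) \<le> u i * (sum u UNIV * T $ i $ j)"
        using u[of i] by simp
      moreover have "0 < (\<Sum>k\<in>UNIV. u k * T $ k $ j)" using u T_pos by (intro sum_pos) auto
      ultimately show ?thesis using su by (simp add: c_def field_simps)
    qed
    have "sum c UNIV = \<kappa>" using su by (simp add: c_def flip: sum_distrib_left sum_divide_distrib)
    have close: "cmod (exp (b i + z * a i) * T' $ i $ j - of_real (u i * T $ i $ j)) \<le> 3 * \<eta> * (u i * T $ i $ j)" for i j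
      unfolding u_def by (rule exp_times_entry_close[OF Im_b[OF z]])
    \<comment> \<open>The averaging bound is applied with \<open>3 * \<eta>\<close> as its relative
      error.\<close>
    have "cmod (S' z p / S z p - S' z q / S z q) \<le> (1 - \<kappa> + 8 * (3 * \<eta>)) * D"
      unfolding S_def S'_def
      using \<eta>_pos \<eta>_less \<kappa>_less u T_pos
      by (intro weighted_average_diff_bound[OF close close _ _ _ _ c c \<open>sum c UNIV = \<kappa>\<close> _ D]) auto
    then show ?thesis by simp
  qed
  from field_differentiable_bound[OF convex_closed_segment DL bound, of 1 0]
  show ?thesis by simp
qed

lemma induced_map_contracts:
  assumes x: "x \<in> relative_nbhd (\<eta> / 2)" and y: "y \<in> relative_nbhd (\<eta> / 2)"
  shows "complex_hilbert_dist (induced_map T' x) (induced_map T' y) \<le> (1 - \<kappa> + 24 * \<eta>) * complex_hilbert_dist x y"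
  unfolding complex_hilbert_dist_le_iff[of "induced_map T' x"]
proof (intro allI)
  fix p q
  let ?D = "complex_hilbert_dist x y"
  define a where "a i = Ln (y $ i) - Ln (x $ i)" for i
  note xc = relative_nbhd_close[OF x] and yc = relative_nbhd_close[OF y]
  have half: "\<bar>Im (Ln (x $ i))\<bar> \<le> 1 / 2" "\<bar>Im (Ln (y $ i))\<bar> \<le> 1 / 2" for i
    using xc(3)[of i] yc(3)[of i] \<eta>_less \<eta>_pos by linarith+
  \<comment> \<open>Small arguments turn the logarithms of cross ratios into differences of the
    \<open>a i\<close>.\<close>
  have D: "cmod (a i - a j) \<le> ?D" for i j
    using complex_hilbert_dist_le_iff[of x y ?D] Ln_cross_ratio[OF xc(1) xc(1) yc(1) yc(1) half(1) half(1) half(2) half(2)]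
    unfolding a_def by auto
  let ?X = "\<lambda>j. (x v* T') $ j" and ?Y = "\<lambda>j. (y v* T') $ j"
  have X: "?X j \<noteq> 0" "\<bar>Im (Ln (?X j))\<bar> \<le> 1 / 2" for j
    unfolding vector_matrix_mult_exp_Ln[OF x] by (rule column_sum_close, rule xc)+
  have Y: "?Y j \<noteq> 0" "\<bar>Im (Ln (?Y j))\<bar> \<le> 1 / 2" for j
    unfolding vector_matrix_mult_exp_Ln[OF y] by (rule column_sum_close, rule yc)+
  have tm: "total_mass T' x \<noteq> 0" "total_mass T' y \<noteq> 0"
    using x y by (auto dest: induced_map_in_simplex_pos)
  \<comment> \<open>The normalizing total masses cancel in the cross ratio.\<close>
  have "Ln ((induced_map T' y $ p / induced_map T' y $ q) / (induced_map T' x $ p / induced_map T' x $ q))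
      = Ln ((?Y p / ?Y q) / (?X p / ?X q))"
    using tm by (simp add: induced_map_def)
  also have "\<dots> = (Ln (?Y p) - Ln (?X p)) - (Ln (?Y q) - Ln (?X q))"
    using X Y by (intro Ln_cross_ratio)
  \<comment> \<open>Regrouped as the increment of one function along the path from \<open>x\<close>
    to \<open>y\<close>: \<open>S 0\<close> is the image of \<open>x\<close> and \<open>S 1\<close>
    that of \<open>y\<close>.\<close>
  also have "\<dots> = (Ln (?Y p) - Ln (?Y q)) - (Ln (?X p) - Ln (?X q))" by simp
  also have "cmod \<dots> \<le> (1 - \<kappa> + 24 * \<eta>) * ?D"
    using log_column_ratio_bound[of "\<lambda>i. Ln (x $ i)" a ?D p q, OF xc(3) _ D] yc(3)
    by (simp add: a_def vector_matrix_mult_exp_Ln[OF x] vector_matrix_mult_exp_Ln[OF y])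
  finally show "cmod (Ln ((induced_map T' y $ p / induced_map T' y $ q) / (induced_map T' x $ p / induced_map T' x $ q)))
     \<le> (1 - \<kappa> + 24 * \<eta>) * ?D" .
qed

lemma induced_contraction:
  assumes "24 * \<eta> < \<kappa>"
  shows "induced_contraction_on T' (relative_nbhd (\<eta> / 2))"
  unfolding induced_contraction_on_def
proof (intro conjI ballI exI[of _ "1 - \<kappa> + 24 * \<eta>"])
  show "relative_nbhd (\<eta> / 2) \<subseteq> complex_simplex_pos"
    using relative_nbhd_close(2) by (auto simp: complex_simplex_pos_def relative_nbhd_def)
qed (use assms \<eta>_pos \<kappa>_less induced_map_in_simplex_pos induced_map_contracts in auto)

end

section \<open>Choice of the constants\<close>

theorem theorem1p3:
  fixes T :: "real ^ 'n ^ 'n"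
  assumes "\<forall>i j. 0 < T $ i $ j"
  shows "\<exists>r > 0. \<exists>\<delta> > 0. \<forall>T' :: complex ^ 'n ^ 'n.
    (\<forall>i j. cmod (complex_of_real (T $ i $ j) - T' $ i $ j) \<le> r) \<longrightarrow>
    induced_contraction_on T' (relative_nbhd \<delta>)"
proof -
  define E where "E = range (\<lambda>(i, j). T $ i $ j)"
  define m where "m = Min E"
  define M where "M = Max E"
  have E: "finite E" "E \<noteq> {}" "\<And>i j. T $ i $ j \<in> E" by (auto simp: E_def)
  have m: "m \<le> T $ i $ j" and M: "T $ i $ j \<le> M" for i j
    using E by (auto simp: m_def M_def)
  have "m \<in> E" unfolding m_def by (rule Min_in) fact+
  then have m0: "0 < m" using assms by (auto simp: E_def)
  then have M0: "m \<le> M" "0 < M" using m[of undefined undefined] M[of undefined undefined] by auto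
  \<comment> \<open>The factor 2 keeps \<kappa> strictly below 1 even if all entries of
    \<open>T\<close> are equal.\<close>
  define \<kappa> where "\<kappa> = m / (2 * M)"
  \<comment> \<open>Then \<open>24 * \<eta>\<close> is \<kappa>/2, giving the contraction factor 1 -
    \<kappa>/2, and \<open>3 * \<eta>\<close> is at most 1/32.\<close>
  define \<eta> where "\<eta> = \<kappa> / 48"
  have \<kappa>: "0 < \<kappa>" "\<kappa> \<le> 1 / 2" using m0 M0 by (auto simp: \<kappa>_def field_simps)
  have ratio: "\<kappa> * T $ k $ j \<le> T $ i $ j" for i j k
  proof -
    have "\<kappa> * T $ k $ j \<le> \<kappa> * M" using \<kappa> M by simp
    also have "\<dots> \<le> m" using m0 M0 by (simp add: \<kappa>_def)
    finally show ?thesis using m[of i j] by linarith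
  qed
  show ?thesis
  \<comment> \<open>With \<open>m\<close> the least entry, an absolute error
    \<open>\<eta> * m\<close> is a relative error of at most \<eta> in every entry.\<close>
  proof (rule exI[of _ "\<eta> * m"], intro conjI, goal_cases)
    case 1
    then show ?case using \<kappa> m0 by (simp add: \<eta>_def)
  next
    case 2
    show ?case
    proof (rule exI[of _ "\<eta> / 2"], intro conjI allI impI, goal_cases)
      case 1
      then show ?case using \<kappa> by (simp add: \<eta>_def)
    next
      case (2 T')
      have "\<eta> * m \<le> \<eta> * T $ i $ j" for i j using m \<kappa> by (simp add: \<eta>_def)
      then have "cmod (T' $ i $ j - of_real (T $ i $ j)) \<le> \<eta> * T $ i $ j" for i j
        using 2 by (metis norm_minus_commute order.trans)
      then interpret positive_matrix_perturbation T T' \<kappa> \<eta>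
        using assms ratio \<kappa> by unfold_locales (auto simp: \<eta>_def)
      show ?case using \<kappa> by (intro induced_contraction) (simp add: \<eta>_def)
    qed
  qed
qed

end
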